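(* Let $G=(V,E)$ be a graph, $t\ge1$ an integer, and let $L(G)$ be its line graph with adjacency matrix $A'$ and eigenvalues $\lambda'_1\ge\lambda'_2\ge\cdots\ge\lambda'_m$, $m=|E|\ge2$. Let $p\in\mathbb{R}_t[x]$, set $W'(p):=\max_{e\in E}(p(A'))_{ee}$ and $\lambda'(p):=\min_{2\le i\le m}p(\lambda'_i)$, and assume $p(\lambda'_1)>\lambda'(p)$. Then $$\chi'_t(G)\ \ge\ \frac{p(\lambda'_1)-\lambda'(p)}{W'(p)-\lambda'(p)}.$$
   Context: All graphs are finite, simple and undirected. The line graph $L(G)$ has vertex set $E$, two edges adjacent iff they share an endpoint. $\chi'_t(G)$ is the least number of colours in a colouring of the edges of $G$ in which any two distinct edges at distance at most $t$ in $L(G)$ get distinct colours (i.e. the chromatic number of $L(G)^t$). $\mathbb{R}_t[x]$ denotes the real polynomials of degree at most $t$. *)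

theory Defs
  imports
    "Jordan_Normal_Form.Char_Poly"
    "HOL-Library.Extended_Nat"
    "HOL-Library.Multiset"
begin

definition simple_graph :: "'a set \<Rightarrow> 'a set set \<Rightarrow> bool" where
  "simple_graph V E \<longleftrightarrow> finite V \<and> (\<forall>e\<in>E. e \<subseteq> V \<and> card e = 2)"

text \<open>The line graph of \<open>(V, E)\<close> is the simple graph \<open>(E, line_edges E)\<close>.\<close>

definition line_edges :: "'a set set \<Rightarrow> 'a set set set" where
  "line_edges E = {{e, f} | e f. e \<in> E \<and> f \<in> E \<and> e \<noteq> f \<and> e \<inter> f \<noteq> {}}"

lemma simple_graph_line_graph:
  assumes "simple_graph V E"
  shows "simple_graph E (line_edges E)"
proof -
  have "finite V" and "E \<subseteq> Pow V"
    using assms by (auto simp: simple_graph_def)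
  then have "finite E"
    by (meson finite_Pow_iff finite_subset)
  then show ?thesis
    by (auto simp: simple_graph_def line_edges_def card_2_iff)
qed

definition walk_betw :: "'a set \<Rightarrow> 'a set set \<Rightarrow> 'a \<Rightarrow> 'a list \<Rightarrow> 'a \<Rightarrow> bool" where
  "walk_betw V E u ws v \<longleftrightarrow>
     ws \<noteq> [] \<and> set ws \<subseteq> V \<and> hd ws = u \<and> last ws = v \<and>
     successively (\<lambda>x y. {x, y} \<in> E) ws"

text \<open>The distance is \<open>\<infinity>\<close> between different connected components.\<close>

definition graph_dist :: "'a set \<Rightarrow> 'a set set \<Rightarrow> 'a \<Rightarrow> 'a \<Rightarrow> enat" where
  "graph_dist V E u v = (INF ws\<in>{ws. walk_betw V E u ws v}. enat (length ws - 1))"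

definition dist_edge_colouring :: "nat \<Rightarrow> 'a set set \<Rightarrow> ('a set \<Rightarrow> nat) \<Rightarrow> bool" where
  "dist_edge_colouring t E c \<longleftrightarrow>
     (\<forall>e\<in>E. \<forall>f\<in>E. e \<noteq> f \<and> graph_dist E (line_edges E) e f \<le> enat t \<longrightarrow> c e \<noteq> c f)"

definition dist_chromatic_index :: "nat \<Rightarrow> 'a set set \<Rightarrow> nat" where
  "dist_chromatic_index t E =
     (LEAST k. \<exists>c. dist_edge_colouring t E c \<and> c ` E \<subseteq> {..<k})"

text \<open>Adjacency matrix of the graph with edge set \<open>E\<close>, whose vertices are enumerated by \<open>vs\<close>.\<close>

definition adjacency_matrix :: "'a list \<Rightarrow> 'a set set \<Rightarrow> real mat" where
  "adjacency_matrix vs E =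
     mat (length vs) (length vs) (\<lambda>(i, j). if {vs ! i, vs ! j} \<in> E then 1 else 0)"

text \<open>
  The \<open>i\<close>-th largest real eigenvalue, counted from 1 and with algebraic multiplicity.
  All roots of the characteristic polynomial are real if \<open>A\<close> is symmetric.
\<close>

definition nth_eigenvalue :: "real mat \<Rightarrow> nat \<Rightarrow> real" where
  "nth_eigenvalue A i = rev (sorted_list_of_multiset (proots (char_poly A))) ! (i - 1)"

definition poly_of_mat :: "real poly \<Rightarrow> real mat \<Rightarrow> real mat" where
  "poly_of_mat p A =
     mat (dim_row A) (dim_row A) (\<lambda>(i, j). \<Sum>k\<le>degree p. coeff p k * (A ^\<^sub>m k) $$ (i, j))"

definition max_diag_poly :: "real poly \<Rightarrow> real mat \<Rightarrow> real" where
  "max_diag_poly p A = Max ((\<lambda>i. poly_of_mat p A $$ (i, i)) ` {..<dim_row A})"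

definition min_poly_eigenvalue :: "real poly \<Rightarrow> real mat \<Rightarrow> real" where
  "min_poly_eigenvalue p A = Min ((\<lambda>i. poly p (nth_eigenvalue A i)) ` {2..dim_row A})"

end

theory Submission
  imports Defs "Jordan_Normal_Form.Schur_Decomposition"
begin

text \<open>
  Let \<open>x\<close> be a unit eigenvector for \<open>\<lambda>'\<^sub>1\<close> and let \<open>y\<close> be its restriction to one colour class, with
  \<open>s = |y|\<^sup>2 = \<langle>x, y\<rangle>\<close>. Diagonalizing \<open>p(A')\<close> gives
  \<open>\<langle>y, p(A') y\<rangle> \<ge> \<lambda>'(p) s + (p(\<lambda>'\<^sub>1) - \<lambda>'(p)) s\<^sup>2\<close>. Two distinct edges of the class have distance
  greater than \<open>t \<ge> degree p\<close>, so the off-diagonal entries of \<open>p(A')\<close> do not contribute and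
  \<open>\<langle>y, p(A') y\<rangle> \<le> W'(p) s\<close>. Hence \<open>(p(\<lambda>'\<^sub>1) - \<lambda>'(p)) s \<le> W'(p) - \<lambda>'(p)\<close> for every class, and the
  values \<open>s\<close> of all classes sum to \<open>|x|\<^sup>2 = 1\<close>.
\<close>

section \<open>The spectral theorem for real symmetric matrices\<close>

lemma prod_list_linear_factors_nonzero:
  fixes as :: "'a :: idom list"
  shows "(\<Prod>a\<leftarrow>as. [:- a, 1:]) \<noteq> 0"
  by (auto simp: prod_list_zero_iff)

text \<open>Over the complex numbers the polynomial splits. For a root \<open>a\<close> with
  eigenvector \<open>v\<close>, evaluating the product of \<open>v\<close> with the conjugate of
  \<open>?M *\<^sub>v v\<close> in two ways gives
  \<open>a * (v \<bullet>c v) = cnj a * (v \<bullet>c v)\<close>, so \<open>a\<close> is real. The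
  factorization then descends along the injective map of polynomial rings.\<close>

lemma real_symmetric_char_poly_splits:
  fixes A :: "real mat"
  assumes A: "A \<in> carrier_mat n n" and sym: "transpose_mat A = A"
  shows "\<exists>as. char_poly A = (\<Prod>a\<leftarrow>as. [:- a, 1:])"
proof -
  let ?M = "map_mat complex_of_real A"
  have M: "?M \<in> carrier_mat n n"
    using A by simp
  obtain as where as: "char_poly ?M = (\<Prod>a\<leftarrow>as. [:- a, 1:])"
    using char_poly_factorized[OF M] by blast
  have real: "complex_of_real (Re a) = a" if "a \<in> set as" for a
  proof -
    have "poly (char_poly ?M) a = 0"
      using that by (auto simp: as poly_prod_list prod_list_zero_iff)
    then obtain v where v: "v \<in> carrier_vec n" "v \<noteq> 0\<^sub>v n" "?M *\<^sub>v v = a \<cdot>\<^sub>v v"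
      using eigenvalue_root_char_poly[OF M] A unfolding eigenvalue_def eigenvector_def by auto
    have conj: "conjugate (?M *\<^sub>v v) = ?M *\<^sub>v conjugate v"
      using A v(1) by (intro eq_vecI) (auto simp: scalar_prod_def)
    have "v \<bullet> (?M *\<^sub>v conjugate v) = cnj a * (v \<bullet>c v)"
      using v by (simp add: conjugate_smult_vec flip: conj)
    moreover have "v \<bullet> (?M *\<^sub>v conjugate v) = (transpose_mat ?M *\<^sub>v v) \<bullet>c v"
      using M v(1) by (intro transpose_vec_mult_scalar[symmetric]) auto
    moreover have "transpose_mat ?M = ?M"
      using sym by (metis map_mat_transpose)
    ultimately have "a * (v \<bullet>c v) = cnj a * (v \<bullet>c v)"
      using v by simp
    then have "cnj a = a"
      using v by simp
    then show ?thesis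
      by (metis Reals_cnj_iff of_real_Re)
  qed
  define bs where "bs = map Re as"
  interpret poly_hom: map_poly_inj_comm_ring_hom complex_of_real ..
  have "map_poly complex_of_real (char_poly A) = char_poly ?M"
    by (rule of_real_hom.char_poly_hom[OF A, symmetric])
  also have "\<dots> = (\<Prod>a\<leftarrow>as. [:- complex_of_real (Re a), 1:])"
    unfolding as by (intro arg_cong[of _ _ prod_list] map_cong) (auto simp: real)
  also have "\<dots> = map_poly complex_of_real (\<Prod>b\<leftarrow>bs. [:- b, 1:])"
    unfolding bs_def by (induction as) (auto simp: hom_distribs simp del: mult_pCons_left)
  finally have "char_poly A = (\<Prod>b\<leftarrow>bs. [:- b, 1:])"
    by simp
  then show ?thesis
    by blast
qed

text \<open>Supplies the orthogonal change of basis that splits off one eigenvector. Gram-Schmidt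
  keeps the first vector of a basis starting with \<open>v\<close>, so normalizing the result only
  rescales \<open>v\<close>.\<close>

lemma orthogonal_matrix_with_first_column:
  fixes v :: "real vec"
  assumes v: "v \<in> carrier_vec n" and v0: "v \<noteq> 0\<^sub>v n"
  obtains H r where "H \<in> carrier_mat n n" "transpose_mat H * H = 1\<^sub>m n" "col H 0 = r \<cdot>\<^sub>v v"
proof -
  interpret cof_vec_space n "TYPE(real)" .
  define b where "b = basis_completion v"
  define ws where "ws = gram_schmidt n b"
  define s where "s w = (1 / sqrt (w \<bullet> w)) \<cdot>\<^sub>v w" for w :: "real vec"
  define H where "H = mat_of_cols n (map s ws)"
  note b = basis_completion[OF v v0, folded b_def]
  have n: "n > 0"
    using v v0 by (cases n) auto
  obtain vs where bv: "b = v # vs"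
    using b n by (cases b) auto
  from gram_schmidt_result[OF b(2,4,5) refl, folded ws_def]
  have ws: "corthogonal ws" "set ws \<subseteq> carrier_vec n" "length ws = n"
    using b by auto
  have hd: "hd ws = v"
    using v unfolding ws_def bv by simp
  have H: "H \<in> carrier_mat n n"
    using ws(3) unfolding H_def by auto
  have wsc: "ws ! i \<in> carrier_vec n" if "i < n" for i
    using ws that by (metis nth_mem subsetD)
  have col: "col H i = s (ws ! i)" if "i < n" for i
    unfolding H_def using that ws(3) wsc[of i] by (subst col_mat_of_cols) (auto simp: s_def)
  have "transpose_mat H * H = 1\<^sub>m n"
  proof (rule eq_matI)
    fix i j assume ij: "i < dim_row (1\<^sub>m n :: real mat)" "j < dim_col (1\<^sub>m n :: real mat)"
    then have c: "ws ! i \<in> carrier_vec n" "ws ! j \<in> carrier_vec n"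
      using wsc by auto
    \<comment> \<open>\<open>corthogonal\<close> yields both directions: distinct vectors are
      orthogonal, and no vector has norm zero, so the normalization is legitimate.\<close>
    have o: "ws ! i \<bullet> ws ! j = 0 \<longleftrightarrow> i \<noteq> j"
      using ws(1,3) ij by (auto simp: corthogonal_def)
    have pos: "ws ! i \<bullet> ws ! i \<ge> 0"
      using conjugate_square_ge_0_vec[of "ws ! i"] c(1) by simp
    have "(transpose_mat H * H) $$ (i, j) = s (ws ! i) \<bullet> s (ws ! j)"
      using H ij by (simp add: col)
    also have "\<dots> = (ws ! i \<bullet> ws ! j) / (sqrt (ws ! i \<bullet> ws ! i) * sqrt (ws ! j \<bullet> ws ! j))"
      using c by (simp add: s_def)
    also have "\<dots> = (1\<^sub>m n) $$ (i, j)"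
      using o pos ij by auto
    finally show "(transpose_mat H * H) $$ (i, j) = (1\<^sub>m n) $$ (i, j)" .
  qed (use H in auto)
  moreover have "col H 0 = (1 / sqrt (v \<bullet> v)) \<cdot>\<^sub>v v"
    using col[OF n] hd ws(3) n by (cases ws) (auto simp: s_def)
  ultimately show thesis
    using that H by blast
qed

text \<open>Deflation by induction on the list of roots: an eigenvector for the first root is split
  off, and the remaining block is symmetric with the remaining roots. The diagonal follows the order
  of \<open>as\<close>, so the caller may choose how the eigenvalues are arranged.\<close>

lemma real_symmetric_diagonalization:
  fixes A :: "real mat"
  assumes "A \<in> carrier_mat n n" and "transpose_mat A = A"
    and "char_poly A = (\<Prod>a\<leftarrow>as. [:- a, 1:])"
  shows "\<exists>U \<in> carrier_mat n n. transpose_mat U * U = 1\<^sub>m n \<and>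
    transpose_mat U * A * U = mat_diag n (nth as)"
  using assms
proof (induction as arbitrary: n A)
  case Nil
  then have "n = 0"
    using degree_monic_char_poly[OF Nil(1)] by simp
  then show ?case
    using Nil by (intro bexI[of _ "1\<^sub>m 0"]) (auto intro!: eq_matI simp: mat_diag_def)
next
  case (Cons a as)
  note A = Cons.prems(1) and sym = Cons.prems(2)
  have "degree (char_poly A) = Suc (degree (\<Prod>a\<leftarrow>as. [:- a, 1:]))"
    using degree_mult_eq[OF _ prod_list_linear_factors_nonzero[of as], of "[:- a, 1:]"]
    by (simp add: Cons.prems(3))
  then obtain m where n: "n = Suc m"
    using degree_monic_char_poly[OF A] by auto
  have "poly (char_poly A) a = 0"
    by (simp add: Cons.prems(3))
  then obtain v where v: "v \<in> carrier_vec n" "v \<noteq> 0\<^sub>v n" "A *\<^sub>v v = a \<cdot>\<^sub>v v"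
    using eigenvalue_root_char_poly[OF A] A unfolding eigenvalue_def eigenvector_def by auto
  obtain H r where H: "H \<in> carrier_mat n n" and HH: "transpose_mat H * H = 1\<^sub>m n"
    and H0: "col H 0 = r \<cdot>\<^sub>v v"
    using orthogonal_matrix_with_first_column[OF v(1,2)] .
  have HT: "transpose_mat H \<in> carrier_mat n n"
    using H by simp
  have HH': "H * transpose_mat H = 1\<^sub>m n"
    using mat_mult_left_right_inverse[OF HT H HH] .
  define B where "B = transpose_mat H * A * H"
  have B: "B \<in> carrier_mat n n"
    using A H unfolding B_def by simp
  have symB: "transpose_mat B = B"
    using A H sym unfolding B_def by (simp add: transpose_mult[of _ n n _ n])
  have "similar_mat_wit B A (transpose_mat H) H"
    using A B H HH HH' by (intro similar_mat_witI[of _ _ n]) (auto simp: B_def)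
  then have charB: "char_poly B = char_poly A"
    by (intro char_poly_similar) (auto simp: similar_mat_def)
  \<comment> \<open>The first column of \<open>H\<close> is a multiple of the eigenvector and the
    columns are orthonormal, so the first column of \<open>B\<close> is \<open>a\<close> times the
    first unit vector. Symmetry of \<open>B\<close> then clears the first row as well.\<close>
  have B0: "B $$ (i, 0) = (if i = 0 then a else 0)" if i: "i < n" for i
  proof -
    have "A *\<^sub>v col H 0 = a \<cdot>\<^sub>v col H 0"
      using A v by (simp add: H0 mult_mat_vec[OF A] smult_smult_assoc mult.commute)
    moreover have "col (A * H) 0 = A *\<^sub>v col H 0"
      using A H n by (intro eq_vecI) auto
    ultimately have "col (A * H) 0 = a \<cdot>\<^sub>v col H 0"
      by simp
    moreover have "B = transpose_mat H * (A * H)"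
      using A H unfolding B_def by simp
    ultimately have "B $$ (i, 0) = a * (col H i \<bullet> col H 0)"
      using A H i n by simp
    also have "col H i \<bullet> col H 0 = (transpose_mat H * H) $$ (i, 0)"
      using H i n by simp
    finally show ?thesis
      using i n by (simp add: HH)
  qed
  define C where "C = mat m m (\<lambda>(i, j). B $$ (Suc i, Suc j))"
  define a1 where "a1 = mat 1 1 (\<lambda>_. a)"
  have C: "C \<in> carrier_mat m m" and a1: "a1 \<in> carrier_mat 1 1"
    by (simp_all add: C_def a1_def)
  have Bsym: "B $$ (i, j) = B $$ (j, i)" if "i < n" "j < n" for i j
    using arg_cong[OF symB, of "\<lambda>M. M $$ (j, i)"] B that by simp
  have Bblock: "B = four_block_mat a1 (0\<^sub>m 1 m) (0\<^sub>m m 1) C"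
    using B n B0 Bsym[of 0] by (intro eq_matI) (auto simp: a1_def C_def)
  have "char_poly B = char_poly a1 * char_poly C"
    unfolding Bblock by (rule char_poly_four_block_zeros_col) (use a1 C in auto)
  moreover have "char_poly a1 = [:- a, 1:]"
    by (subst char_poly_upper_triangular[OF a1]) (auto simp: a1_def diag_mat_def)
  \<comment> \<open>Cancelling the linear factor of \<open>a\<close> leaves exactly the roots
    \<open>as\<close> for \<open>C\<close>, as the induction hypothesis requires.\<close>
  ultimately have "[:- a, 1:] * char_poly C = [:- a, 1:] * (\<Prod>a\<leftarrow>as. [:- a, 1:])"
    using Cons.prems(3) charB by simp
  then have "char_poly C = (\<Prod>a\<leftarrow>as. [:- a, 1:])"
    by (metis mult_cancel_left pCons_eq_0_iff one_neq_zero)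
  moreover have "transpose_mat C = C"
    using Bsym n by (intro eq_matI) (auto simp: C_def)
  ultimately obtain U where U: "U \<in> carrier_mat m m" "transpose_mat U * U = 1\<^sub>m m"
    "transpose_mat U * C * U = mat_diag m (nth as)"
    using Cons.IH[OF C] by blast
  \<comment> \<open>\<open>K\<close> leaves the split-off coordinate fixed and diagonalizes the
    block \<open>C\<close>; the required orthogonal matrix is \<open>H * K\<close>.\<close>
  define K where "K = four_block_mat (1\<^sub>m 1) (0\<^sub>m 1 m) (0\<^sub>m m 1) U"
  have K: "K \<in> carrier_mat n n"
    using U n unfolding K_def by auto
  have KT: "transpose_mat K = four_block_mat (1\<^sub>m 1) (0\<^sub>m 1 m) (0\<^sub>m m 1) (transpose_mat U)"
    unfolding K_def using U by (subst transpose_four_block_mat) auto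
  have KK: "transpose_mat K * K = 1\<^sub>m n"
    unfolding KT unfolding K_def
    by (subst mult_four_block_mat[where ?n1.0 = 1 and ?n2.0 = m]) (use U n in auto)
  have "transpose_mat K * B * K =
      four_block_mat a1 (0\<^sub>m 1 m) (0\<^sub>m m 1) (transpose_mat U * C * U)"
    unfolding KT Bblock unfolding K_def using U(1) a1 C
    by (simp add: mult_four_block_mat[of _ 1 1 _ m _ m _ _ 1 _ m])
  also have "\<dots> = mat_diag n (nth (a # as))"
    unfolding U(3) using n by (intro eq_matI) (auto simp: mat_diag_def a1_def nth_Cons')
  finally have KBK: "transpose_mat K * B * K = mat_diag n (nth (a # as))" .
  have "transpose_mat (H * K) * (H * K) = transpose_mat K * (transpose_mat H * H) * K"
    using H K by (simp add: transpose_mult[of _ n n _ n] assoc_mult_mat[of _ n n _ n _ n])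
  moreover have "transpose_mat (H * K) * A * (H * K) = transpose_mat K * B * K"
    unfolding B_def using H K A
    by (simp add: transpose_mult[of _ n n _ n] assoc_mult_mat[of _ n n _ n _ n])
  ultimately show ?case
    using H K KK KBK HH by (intro bexI[of _ "H * K"]) auto
qed

text \<open>Here \<open>u k\<close> is column \<open>k\<close> of an orthogonal matrix
  \<open>U\<close> diagonalizing \<open>A\<close>. The first two facts are the entries of
  \<open>transpose_mat U * U = 1\<^sub>m n\<close> and
  \<open>U * transpose_mat U = 1\<^sub>m n\<close>: orthonormality and completeness.\<close>

lemma symmetric_spectral_decomposition:
  fixes A :: "real mat"
  assumes A: "A \<in> carrier_mat n n" and sym: "transpose_mat A = A"
  obtains u :: "nat \<Rightarrow> nat \<Rightarrow> real" where
    "\<And>k l. k < n \<Longrightarrow> l < n \<Longrightarrow> (\<Sum>i<n. u k i * u l i) = (if k = l then 1 else 0)"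
    "\<And>i j. i < n \<Longrightarrow> j < n \<Longrightarrow> (\<Sum>k<n. u k i * u k j) = (if i = j then 1 else 0)"
    "\<And>i j. i < n \<Longrightarrow> j < n \<Longrightarrow>
      A $$ (i, j) = (\<Sum>k<n. nth_eigenvalue A (Suc k) * u k i * u k j)"
proof -
  obtain bs where bs: "char_poly A = (\<Prod>a\<leftarrow>bs. [:- a, 1:])"
    using real_symmetric_char_poly_splits[OF assms] by blast
  have "proots (\<Prod>a\<leftarrow>bs. [:- a, 1:]) = mset bs"
  proof (induction bs)
    case (Cons b bs)
    then show ?case
      using proots_mult[OF _ prod_list_linear_factors_nonzero[of bs], of "[:- b, 1:]"] by simp
  qed simp
  then have roots: "proots (char_poly A) = mset bs"
    by (simp add: bs)
  \<comment> \<open>The product of linear factors depends only on the multiset of roots, so they may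
    be put in decreasing order. Position \<open>k\<close> then holds the eigenvalue numbered
    \<open>Suc k\<close>, as \<open>nth_eigenvalue\<close> counts from 1.\<close>
  define as where "as = rev (sort bs)"
  have nth_as: "nth_eigenvalue A (Suc k) = as ! k" for k
    by (simp add: nth_eigenvalue_def roots as_def)
  have "char_poly A = (\<Prod>a\<leftarrow>as. [:- a, 1:])"
    unfolding bs by (simp add: as_def flip: prod_mset_prod_list)
  then obtain U where U: "U \<in> carrier_mat n n" and UU: "transpose_mat U * U = 1\<^sub>m n"
    and UAU: "transpose_mat U * A * U = mat_diag n (nth as)"
    using real_symmetric_diagonalization[OF assms] by blast
  have UT: "transpose_mat U \<in> carrier_mat n n"
    using U by simp
  have UU': "U * transpose_mat U = 1\<^sub>m n"
    using mat_mult_left_right_inverse[OF UT U UU] .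
  have "U * mat_diag n (nth as) * transpose_mat U =
      (U * transpose_mat U) * A * (U * transpose_mat U)"
    unfolding UAU[symmetric] using U A by (simp add: assoc_mult_mat[of _ n n _ n _ n])
  then have AU: "A = U * mat_diag n (nth as) * transpose_mat U"
    using A by (simp add: UU')
  show thesis
  proof
    show "(\<Sum>i<n. U $$ (i, k) * U $$ (i, l)) = (if k = l then 1 else 0)"
      if "k < n" "l < n" for k l
      using arg_cong[OF UU, of "\<lambda>M. M $$ (k, l)"] that U
      by (simp add: scalar_prod_def lessThan_atLeast0)
    show "(\<Sum>k<n. U $$ (i, k) * U $$ (j, k)) = (if i = j then 1 else 0)"
      if "i < n" "j < n" for i j
      using arg_cong[OF UU', of "\<lambda>M. M $$ (i, j)"] that U
      by (simp add: scalar_prod_def lessThan_atLeast0)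
    show "A $$ (i, j) = (\<Sum>k<n. nth_eigenvalue A (Suc k) * U $$ (i, k) * U $$ (j, k))"
      if "i < n" "j < n" for i j
      using arg_cong[OF AU, of "\<lambda>M. M $$ (i, j)"] that U
      by (simp add: scalar_prod_def lessThan_atLeast0 mat_diag_mult_right[OF U] nth_as mult_ac)
  qed
qed

section \<open>Polynomials of a symmetric matrix and their quadratic forms\<close>

lemma poly_of_mat_spectral:
  fixes A :: "real mat"
  assumes A: "A \<in> carrier_mat n n"
    and orth: "\<And>k l. k < n \<Longrightarrow> l < n \<Longrightarrow> (\<Sum>i<n. u k i * u l i) = (if k = l then 1 else 0)"
    and orth': "\<And>i j. i < n \<Longrightarrow> j < n \<Longrightarrow> (\<Sum>k<n. u k i * u k j) = (if i = j then 1 else 0)"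
    and spec: "\<And>i j. i < n \<Longrightarrow> j < n \<Longrightarrow> A $$ (i, j) = (\<Sum>k<n. ev k * u k i * u k j)"
    and ij: "i < n" "j < n"
  shows "poly_of_mat p A $$ (i, j) = (\<Sum>k<n. poly p (ev k) * u k i * u k j)"
proof -
  have pow: "(A ^\<^sub>m m) $$ (i, j) = (\<Sum>k<n. ev k ^ m * u k i * u k j)" if "j < n" for m j
    using that
  proof (induction m arbitrary: j)
    \<comment> \<open>The power 0 is the identity matrix, whose expansion is the completeness
      relation \<open>orth'\<close>.\<close>
    case 0
    then show ?case
      using A ij orth' by simp
  next
    case (Suc m)
    have "(A ^\<^sub>m Suc m) $$ (i, j) = (\<Sum>h<n. (A ^\<^sub>m m) $$ (i, h) * A $$ (h, j))"
      using A ij Suc.prems by (simp add: scalar_prod_def lessThan_atLeast0)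
    also have "\<dots> = (\<Sum>h<n. (\<Sum>k<n. ev k ^ m * u k i * u k h) * (\<Sum>l<n. ev l * u l h * u l j))"
      using Suc by (intro sum.cong) (auto simp: spec)
    also have "\<dots> = (\<Sum>h<n. \<Sum>k<n. \<Sum>l<n. ev k ^ m * u k i * ev l * u l j * (u k h * u l h))"
      unfolding sum_product by (simp add: mult_ac)
    \<comment> \<open>With the sum over \<open>h\<close> innermost, orthonormality of
      \<open>u k\<close> and \<open>u l\<close> leaves only the terms with
      \<open>k = l\<close>.\<close>
    also have "\<dots> = (\<Sum>k<n. \<Sum>l<n. \<Sum>h<n. ev k ^ m * u k i * ev l * u l j * (u k h * u l h))"
      by (subst sum.swap) (intro sum.cong refl sum.swap)
    also have "\<dots> = (\<Sum>k<n. \<Sum>l<n. ev k ^ m * u k i * ev l * u l j * (if k = l then 1 else 0))"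
      by (intro sum.cong refl) (simp add: orth flip: sum_distrib_left)
    also have "\<dots> = (\<Sum>k<n. ev k ^ Suc m * u k i * u k j)"
      by (simp add: if_distrib[of "(*) _"] mult_ac cong: if_cong)
    finally show ?case .
  qed
  have "poly_of_mat p A $$ (i, j) =
      (\<Sum>m\<le>degree p. \<Sum>k<n. coeff p m * (ev k ^ m * u k i * u k j))"
    using A ij by (simp add: poly_of_mat_def pow sum_distrib_left)
  also have "\<dots> = (\<Sum>k<n. poly p (ev k) * u k i * u k j)"
    by (subst sum.swap) (simp add: poly_altdef sum_distrib_left sum_distrib_right mult_ac)
  finally show ?thesis .
qed

text \<open>In the eigenbasis, where \<open>y\<close> has coordinates \<open>c k\<close>, the form
  is the sum of \<open>poly p (ev k) * (c k)\<^sup>2\<close>. The term for the largest eigenvalue is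
  kept exactly and every other coefficient is bounded below by the minimum. The vector
  \<open>x\<close> is the first eigenvector, fixed before \<open>y\<close>, so that one
  \<open>x\<close> serves all colour classes.\<close>

lemma poly_of_mat_quadratic_form_ge:
  fixes A :: "real mat"
  assumes A: "A \<in> carrier_mat n n" and sym: "transpose_mat A = A" and n: "n > 0"
  obtains x :: "nat \<Rightarrow> real" where "(\<Sum>i<n. (x i)\<^sup>2) = 1"
    and "\<And>y. (\<Sum>i<n. \<Sum>j<n. y i * poly_of_mat p A $$ (i, j) * y j) \<ge>
      min_poly_eigenvalue p A * (\<Sum>i<n. (y i)\<^sup>2) +
      (poly p (nth_eigenvalue A 1) - min_poly_eigenvalue p A) * (\<Sum>i<n. x i * y i)\<^sup>2"
proof -
  define ev where "ev k = nth_eigenvalue A (Suc k)" for k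
  obtain u :: "nat \<Rightarrow> nat \<Rightarrow> real" where
    orth: "\<And>k l. k < n \<Longrightarrow> l < n \<Longrightarrow> (\<Sum>i<n. u k i * u l i) = (if k = l then 1 else 0)" and
    orth': "\<And>i j. i < n \<Longrightarrow> j < n \<Longrightarrow> (\<Sum>k<n. u k i * u k j) = (if i = j then 1 else 0)" and
    spec: "\<And>i j. i < n \<Longrightarrow> j < n \<Longrightarrow> A $$ (i, j) = (\<Sum>k<n. ev k * u k i * u k j)"
    using symmetric_spectral_decomposition[OF A sym] unfolding ev_def by blast
  let ?mu = "min_poly_eigenvalue p A"
  show thesis
  proof
    show "(\<Sum>i<n. (u 0 i)\<^sup>2) = 1"
      using orth[of 0 0] n by (simp add: power2_eq_square)
    fix y :: "nat \<Rightarrow> real"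
    define c where "c k = (\<Sum>i<n. u k i * y i)" for k
    \<comment> \<open>Applied twice: constant weights 1 give the squared norm of \<open>y\<close>,
      and the weights \<open>poly p (ev k)\<close> give the form of
      \<open>poly_of_mat p A\<close>.\<close>
    have form: "(\<Sum>i<n. \<Sum>j<n. y i * (\<Sum>k<n. f k * u k i * u k j) * y j) = (\<Sum>k<n. f k * (c k)\<^sup>2)"
      for f :: "nat \<Rightarrow> real"
    proof -
      have "(\<Sum>i<n. \<Sum>j<n. y i * (\<Sum>k<n. f k * u k i * u k j) * y j) =
          (\<Sum>i<n. \<Sum>j<n. \<Sum>k<n. f k * ((u k i * y i) * (u k j * y j)))"
        by (simp add: sum_distrib_left sum_distrib_right mult_ac)
      also have "\<dots> = (\<Sum>i<n. \<Sum>k<n. \<Sum>j<n. f k * ((u k i * y i) * (u k j * y j)))"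
        by (intro sum.cong refl sum.swap)
      also have "\<dots> = (\<Sum>k<n. \<Sum>i<n. \<Sum>j<n. f k * ((u k i * y i) * (u k j * y j)))"
        by (rule sum.swap)
      also have "\<dots> = (\<Sum>k<n. f k * (c k)\<^sup>2)"
        unfolding c_def power2_eq_square sum_product by (simp only: sum_distrib_left)
      finally show ?thesis .
    qed
    have "(\<Sum>i<n. (y i)\<^sup>2) = (\<Sum>i<n. \<Sum>j<n. y i * (if i = j then 1 else 0) * y j)"
      by (simp add: power2_eq_square if_distrib[of "(*) _"] if_distrib[of "\<lambda>z. z * _"] cong: if_cong)
    also have "\<dots> = (\<Sum>i<n. \<Sum>j<n. y i * (\<Sum>k<n. 1 * u k i * u k j) * y j)"
      by (intro sum.cong refl) (simp add: orth')
    also have "\<dots> = (\<Sum>k<n. 1 * (c k)\<^sup>2)"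
      by (rule form)
    finally have norm: "(\<Sum>i<n. (y i)\<^sup>2) = (\<Sum>k<n. (c k)\<^sup>2)"
      by simp
    \<comment> \<open>Since \<open>ev\<close> counts from 0, the positive indices \<open>k\<close>
      match the range \<open>{2..dim_row A}\<close> of the minimum. If \<open>n = 1\<close>, that
      minimum is over the empty set, but then there is no such \<open>k\<close>.\<close>
    have mu: "?mu \<le> poly p (ev k)" if "0 < k" "k < n" for k
      unfolding min_poly_eigenvalue_def ev_def using A that
      by (intro Min_le) (auto intro!: image_eqI[of _ _ "Suc k"])
    obtain m where m: "n = Suc m"
      using n by (cases n) auto
    have "?mu * (\<Sum>i<n. (y i)\<^sup>2) + (poly p (ev 0) - ?mu) * (c 0)\<^sup>2 =
        poly p (ev 0) * (c 0)\<^sup>2 + (\<Sum>k<m. ?mu * (c (Suc k))\<^sup>2)"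
      unfolding norm unfolding m sum.lessThan_Suc_shift by (simp add: algebra_simps sum_distrib_left)
    also have "\<dots> \<le> poly p (ev 0) * (c 0)\<^sup>2 + (\<Sum>k<m. poly p (ev (Suc k)) * (c (Suc k))\<^sup>2)"
      using mu m by (intro add_left_mono sum_mono mult_right_mono) auto
    also have "\<dots> = (\<Sum>k<n. poly p (ev k) * (c k)\<^sup>2)"
      unfolding m sum.lessThan_Suc_shift by simp
    also have "\<dots> = (\<Sum>i<n. \<Sum>j<n. y i * poly_of_mat p A $$ (i, j) * y j)"
      unfolding form[symmetric]
      by (intro sum.cong refl) (simp add: poly_of_mat_spectral[OF A orth orth' spec])
    finally show "(\<Sum>i<n. \<Sum>j<n. y i * poly_of_mat p A $$ (i, j) * y j) \<ge>
      ?mu * (\<Sum>i<n. (y i)\<^sup>2) +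
      (poly p (nth_eigenvalue A 1) - ?mu) * (\<Sum>i<n. u 0 i * y i)\<^sup>2"
      by (simp add: ev_def c_def)
  qed
qed

section \<open>Powers of the adjacency matrix and distance\<close>

lemma adjacency_matrix_carrier [simp]:
  "adjacency_matrix vs E \<in> carrier_mat (length vs) (length vs)"
  by (simp add: adjacency_matrix_def)

lemma adjacency_matrix_symmetric: "transpose_mat (adjacency_matrix vs E) = adjacency_matrix vs E"
  by (intro eq_matI) (auto simp: adjacency_matrix_def insert_commute)

text \<open>A nonzero entry of the next power forces some nonzero product of an entry
  \<open>(i, h)\<close> of the previous power with an adjacency entry \<open>(h, j)\<close>, so a
  walk to \<open>h\<close> extends by one edge. A walk with \<open>k\<close> steps lists
  \<open>Suc k\<close> vertices.\<close>

lemma walk_if_adjacency_matrix_power_nonzero: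
  assumes "i < length vs" "j < length vs" "(adjacency_matrix vs E ^\<^sub>m k) $$ (i, j) \<noteq> 0"
  shows "\<exists>ws. walk_betw (set vs) E (vs ! i) ws (vs ! j) \<and> length ws = Suc k"
  using assms(2,3)
proof (induction k arbitrary: j)
  case 0
  then have "i = j"
    using assms(1) by (auto simp: adjacency_matrix_def split: if_splits)
  then show ?case
    using assms(1) by (intro exI[of _ "[vs ! i]"]) (auto simp: walk_betw_def)
next
  case (Suc k)
  let ?A = "adjacency_matrix vs E"
  have "(?A ^\<^sub>m Suc k) $$ (i, j) = (\<Sum>h<length vs. (?A ^\<^sub>m k) $$ (i, h) * ?A $$ (h, j))"
    using assms(1) Suc.prems(1) adjacency_matrix_carrier[of vs E]
    by (simp add: scalar_prod_def lessThan_atLeast0 del: adjacency_matrix_carrier)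
  with Suc.prems(2) obtain h where h: "h < length vs" "(?A ^\<^sub>m k) $$ (i, h) \<noteq> 0" "?A $$ (h, j) \<noteq> 0"
    by (metis (no_types, lifting) lessThan_iff mult_eq_0_iff sum.neutral)
  obtain ws where ws: "walk_betw (set vs) E (vs ! i) ws (vs ! h)" "length ws = Suc k"
    using Suc.IH[OF h(1,2)] by blast
  have "{vs ! h, vs ! j} \<in> E"
    using h Suc.prems(1) by (auto simp: adjacency_matrix_def split: if_splits)
  then have "walk_betw (set vs) E (vs ! i) (ws @ [vs ! j]) (vs ! j)"
    using ws Suc.prems(1) by (auto simp: walk_betw_def successively_append_iff)
  then show ?case
    using ws(2) by (intro exI[of _ "ws @ [vs ! j]"]) simp
qed

text \<open>A nonzero entry in any power up to \<open>degree p\<close> would give a walk with at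
  most \<open>t\<close> steps, contradicting the distance.\<close>

lemma poly_of_adjacency_matrix_eq_0:
  assumes "i < length vs" "j < length vs" "degree p \<le> t"
    and "\<not> graph_dist (set vs) E (vs ! i) (vs ! j) \<le> enat t"
  shows "poly_of_mat p (adjacency_matrix vs E) $$ (i, j) = 0"
proof -
  have "(adjacency_matrix vs E ^\<^sub>m k) $$ (i, j) = 0" if "k \<le> degree p" for k
  proof (rule ccontr)
    assume "(adjacency_matrix vs E ^\<^sub>m k) $$ (i, j) \<noteq> 0"
    then obtain ws where "walk_betw (set vs) E (vs ! i) ws (vs ! j)" "length ws = Suc k"
      using walk_if_adjacency_matrix_power_nonzero[OF assms(1,2)] by blast
    then have "graph_dist (set vs) E (vs ! i) (vs ! j) \<le> enat k"
      unfolding graph_dist_def by (intro INF_lower2[of ws]) auto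
    then have "graph_dist (set vs) E (vs ! i) (vs ! j) \<le> enat t"
      using that assms(3) by (meson enat_ord_simps(1) order.trans)
    with assms(4) show False
      by simp
  qed
  then show ?thesis
    using assms(1,2) by (simp add: poly_of_mat_def adjacency_matrix_def)
qed

section \<open>Colour classes and the bound\<close>

lemma dist_chromatic_index_attained:
  assumes "finite E"
  obtains c where "dist_edge_colouring t E c" "c ` E \<subseteq> {..<dist_chromatic_index t E}"
proof -
  \<comment> \<open>An injective colouring is always admissible, so the set under
    \<open>LEAST\<close> is nonempty and its minimum is attained.\<close>
  obtain c :: "'a set \<Rightarrow> nat" where "bij_betw c E {0..<card E}"
    using ex_bij_betw_finite_nat[OF assms] by blast
  then have "dist_edge_colouring t E c \<and> c ` E \<subseteq> {..<card E}"
    by (auto simp: dist_edge_colouring_def bij_betw_def inj_on_def)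
  then have "\<exists>k c. dist_edge_colouring t E c \<and> c ` E \<subseteq> {..<k}"
    by blast
  then have "\<exists>c. dist_edge_colouring t E c \<and> c ` E \<subseteq> {..<dist_chromatic_index t E}"
    unfolding dist_chromatic_index_def by (rule LeastI_ex)
  then show thesis
    using that by blast
qed

theorem theorem3p3:
  fixes V :: "'a set" and E :: "'a set set" and es :: "'a set list"
    and t :: nat and p :: "real poly" and A' :: "real mat"
  assumes "simple_graph V E"
    and "card E \<ge> 2"
    and "t \<ge> 1"
    and "distinct es" and "set es = E"
    and "A' = adjacency_matrix es (line_edges E)"
    and "degree p \<le> t"
    and "poly p (nth_eigenvalue A' 1) > min_poly_eigenvalue p A'"
  shows "real (dist_chromatic_index t E) \<ge>
    (poly p (nth_eigenvalue A' 1) - min_poly_eigenvalue p A') /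
    (max_diag_poly p A' - min_poly_eigenvalue p A')"
proof -
  define n where "n = length es"
  define q where "q = dist_chromatic_index t E"
  define mu where "mu = min_poly_eigenvalue p A'"
  define W where "W = max_diag_poly p A'"
  define D where "D = poly p (nth_eigenvalue A' 1) - mu"
  have D: "D > 0"
    using assms(8) by (simp add: D_def mu_def)
  have n: "n > 0"
    using assms(2,5) by (auto simp: n_def)
  have A: "A' \<in> carrier_mat n n"
    by (simp add: assms(6) n_def)
  have sym: "transpose_mat A' = A'"
    unfolding assms(6) by (rule adjacency_matrix_symmetric)
  obtain c where c: "dist_edge_colouring t E c" "c ` E \<subseteq> {..<q}"
    using dist_chromatic_index_attained[of E t] assms(5) unfolding q_def by blast
  obtain x where x: "(\<Sum>i<n. (x i)\<^sup>2) = 1"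
    and ge: "\<And>y. (\<Sum>i<n. \<Sum>j<n. y i * poly_of_mat p A' $$ (i, j) * y j) \<ge>
      mu * (\<Sum>i<n. (y i)\<^sup>2) + D * (\<Sum>i<n. x i * y i)\<^sup>2"
    using poly_of_mat_quadratic_form_ge[OF A sym n, of p] unfolding D_def mu_def by blast
  define s where "s a = (\<Sum>i<n. if c (es ! i) = a then (x i)\<^sup>2 else 0)" for a
  have s_nonneg: "s a \<ge> 0" for a
    unfolding s_def by (intro sum_nonneg) auto
  \<comment> \<open>The two estimates of the quadratic form share a factor \<open>s a\<close>, which
    must be positive to be cancelled.\<close>
  have class_bound: "D * s a \<le> W - mu" if pos: "s a > 0" for a
  proof -
    define y where "y i = (if c (es ! i) = a then x i else 0)" for i
    have y_sq: "(\<Sum>i<n. (y i)\<^sup>2) = s a" and xy: "(\<Sum>i<n. x i * y i) = s a"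
      unfolding s_def y_def by (auto intro!: sum.cong simp: power2_eq_square)
    \<comment> \<open>Either a factor of \<open>y\<close> vanishes, or both edges have colour
      \<open>a\<close> and are therefore too far apart for \<open>p\<close> to see.\<close>
    have off: "y i * poly_of_mat p A' $$ (i, j) * y j = 0" if "i < n" "j < n" "i \<noteq> j" for i j
    proof (cases "c (es ! i) = a \<and> c (es ! j) = a")
      case True
      moreover have "es ! i \<in> E" "es ! j \<in> E" "es ! i \<noteq> es ! j"
        using that assms(4,5) by (auto simp: n_def nth_eq_iff_index_eq)
      ultimately have "\<not> graph_dist E (line_edges E) (es ! i) (es ! j) \<le> enat t"
        using c(1) unfolding dist_edge_colouring_def by metis
      then show ?thesis
        using poly_of_adjacency_matrix_eq_0[of i es j p t "line_edges E"] that assms(5-7)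
        by (simp add: n_def)
    qed (auto simp: y_def)
    have diag: "poly_of_mat p A' $$ (i, i) \<le> W" if "i < n" for i
      unfolding W_def max_diag_poly_def using A that by (intro Max_ge) auto
    have "mu * s a + D * (s a)\<^sup>2 \<le> (\<Sum>i<n. \<Sum>j<n. y i * poly_of_mat p A' $$ (i, j) * y j)"
      using ge[of y] by (simp add: y_sq xy)
    also have "\<dots> = (\<Sum>i<n. y i * poly_of_mat p A' $$ (i, i) * y i)"
    proof (intro sum.cong refl)
      fix i assume "i \<in> {..<n}"
      then show "(\<Sum>j<n. y i * poly_of_mat p A' $$ (i, j) * y j) =
          y i * poly_of_mat p A' $$ (i, i) * y i"
        by (subst sum.remove[of _ i]) (auto intro!: sum.neutral off)
    qed
    also have "\<dots> = (\<Sum>i<n. poly_of_mat p A' $$ (i, i) * (y i)\<^sup>2)"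
      by (simp add: power2_eq_square mult_ac)
    also have "\<dots> \<le> (\<Sum>i<n. W * (y i)\<^sup>2)"
      using diag by (intro sum_mono mult_right_mono) auto
    also have "\<dots> = W * s a"
      by (simp add: y_sq flip: sum_distrib_left)
    finally have "(D * s a) * s a \<le> (W - mu) * s a"
      by (simp add: algebra_simps power2_eq_square)
    with pos show ?thesis
      by simp
  qed
  \<comment> \<open>Every edge has exactly one colour below \<open>q\<close>, so the class weights
    add up to the squared norm of \<open>x\<close>.\<close>
  have "(\<Sum>a<q. s a) = (\<Sum>i<n. \<Sum>a<q. if c (es ! i) = a then (x i)\<^sup>2 else 0)"
    unfolding s_def by (rule sum.swap)
  also have "\<dots> = (\<Sum>i<n. (x i)\<^sup>2)"
  proof (intro sum.cong refl)
    fix i assume "i \<in> {..<n}"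
    then have "c (es ! i) < q"
      using c(2) assms(5) by (force simp: n_def)
    then show "(\<Sum>a<q. if c (es ! i) = a then (x i)\<^sup>2 else 0) = (x i)\<^sup>2"
      by simp
  qed
  finally have sum_s: "(\<Sum>a<q. s a) = 1"
    using x by simp
  \<comment> \<open>Some class must carry positive weight, and its bound shows that the denominator
    \<open>W - mu\<close> is positive.\<close>
  then obtain a where "s a > 0"
    using s_nonneg by (metis less_eq_real_def sum.neutral zero_neq_one)
  then have W: "W - mu > 0"
    using class_bound[of a] D by (smt (verit) mult_pos_pos)
  have "D = (\<Sum>a<q. D * s a)"
    using sum_s by (simp flip: sum_distrib_left)
  \<comment> \<open>Classes of weight zero escape \<open>class_bound\<close>; for them the estimate
    is just \<open>W - mu > 0\<close>.\<close>
  also have "\<dots> \<le> (\<Sum>a<q. W - mu)"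
    using class_bound s_nonneg W by (intro sum_mono) (metis less_eq_real_def mult_zero_right)
  finally have "D \<le> real q * (W - mu)"
    by simp
  then have "D / (W - mu) \<le> real q"
    using W by (simp add: divide_le_eq)
  then show ?thesis
    by (simp add: D_def W_def mu_def q_def)
qed

end
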